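(* Let $n\ge2$ and $w_1,\dots,w_n>0$. For $p\ge1$ let $\Delta_p=\{(z_1,\dots,z_p)\in\mathbb{R}^p:\ z_1\le z_2\le\dots\le z_p\}$. Then the function from $\Delta_n$ to $\Delta_{n-1}$ which maps $(z_1,\dots,z_n)$ to the nondecreasing sequence of roots, counted with multiplicity, of the polynomial $$\sum_{j=1}^n w_j\prod_{1\le\ell\le n,\ \ell\ne j}(z-z_\ell)$$ is increasing for the partial order $\preccurlyeq$ defined on $\Delta_p$ by: $(z_1,\dots,z_p)\preccurlyeq(z'_1,\dots,z'_p)$ if and only if $z_j\le z'_j$ for $1\le j\le p$. Moreover, if $w_1=w_2=\dots=w_n$, this function is $n/(n-1)$-Lipschitz for the Lévy metric $L$ between empirical measures.
   Context: A function $f$ between partially ordered sets is increasing if $z\preccurlyeq z'$ and $z\ne z'$ imply $f(z)\preccurlyeq f(z')$ and $f(z)\neq f(z')$. The empirical measure of $(z_1,\dots,z_p)\in\Delta_p$ is $\frac1p\sum_{j=1}^p\delta_{z_j}$, where $\delta_z$ is the Dirac measure at $z$. The Lévy metric between probability measures $\mathbb{P},\mathbb{Q}$ on $\mathbb{R}$, with distribution functions $F_{\mathbb{P}},F_{\mathbb{Q}}$, is $$L(\mathbb{P},\mathbb{Q})=\inf\{\varepsilon>0:\ \forall x\in\mathbb{R},\ F_{\mathbb{P}}(x-\varepsilon)-\varepsilon\le F_{\mathbb{Q}}(x)\le F_{\mathbb{P}}(x+\varepsilon)+\varepsilon\}.$$ The Lipschitz property means that the Lévy distance between the empirical measures of the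 images of two points of $\Delta_n$ is at most $\frac{n}{n-1}$ times the Lévy distance between the empirical measures of these two points. *)

theory Defs
  imports
    "HOL-Probability.Probability"
    "HOL-Computational_Algebra.Computational_Algebra"
begin

text \<open>
  A point of $\Delta_p$ is a sorted list of length p; indices start at 0, so
  the coordinate $z_j$ is the list element with index $j - 1$.
\<close>

definition Delta :: "nat \<Rightarrow> real list set" where
  "Delta p = {z. length z = p \<and> sorted z}"

definition coord_le :: "real list \<Rightarrow> real list \<Rightarrow> bool" where
  "coord_le z z' \<longleftrightarrow> list_all2 (\<le>) z z'"

lemma partial_order_on_Delta:
  "partial_order_on (Delta p) {(z, z'). z \<in> Delta p \<and> z' \<in> Delta p \<and> coord_le z z'}"
proof -
  have "coord_le z z" for z
    by (simp add: coord_le_def list_all2_refl)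
  moreover have "coord_le x z" if "coord_le x y" "coord_le y z" for x y z
    using that order_trans by (fastforce simp: coord_le_def list_all2_conv_all_nth)
  moreover have "x = y" if "coord_le x y" "coord_le y x" for x y
    using that unfolding coord_le_def
    by (intro nth_equalityI) (auto simp: list_all2_conv_all_nth intro: antisym)
  ultimately show ?thesis
    unfolding partial_order_on_def preorder_on_def refl_on_def trans_def antisym_def
    by blast
qed

text \<open>``Increasing'' is the strict notion: distinct comparable points have distinct images.\<close>

definition increasing_on ::
  "'a set \<Rightarrow> ('a \<Rightarrow> 'a \<Rightarrow> bool) \<Rightarrow> ('b \<Rightarrow> 'b \<Rightarrow> bool) \<Rightarrow> ('a \<Rightarrow> 'b) \<Rightarrow> bool" where
  "increasing_on A le le' f \<longleftrightarrow>
     (\<forall>z\<in>A. \<forall>z'\<in>A. le z z' \<and> z \<noteq> z' \<longrightarrow> le' (f z) (f z') \<and> f z \<noteq> f z')"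

definition weighted_poly :: "real list \<Rightarrow> real list \<Rightarrow> real poly" where
  "weighted_poly w z =
     (\<Sum>j<length z. smult (w ! j) (\<Prod>l\<in>{..<length z} - {j}. [:- (z ! l), 1:]))"

text \<open>
  Only real roots are collected here. For n points and positive weights the polynomial
  has degree n - 1 (its leading coefficient is the sum of the weights), so that the
  list having length n - 1 means exactly that all its complex roots are real.
\<close>

definition root_map :: "real list \<Rightarrow> real list \<Rightarrow> real list" where
  "root_map w z = sorted_list_of_multiset (proots (weighted_poly w z))"

definition empirical_measure :: "real list \<Rightarrow> real measure" where
  "empirical_measure z =
     measure_of UNIV (sets borel)
       (\<lambda>A. ennreal (1 / real (length z)) * (\<Sum>j<length z. emeasure (return borel (z ! j)) A))"

text \<open>
  The function passed to \<^const>\<open>measure_of\<close> is indeed a measure (otherwise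
  \<^const>\<open>measure_of\<close> would silently produce the zero measure).
\<close>

lemma sets_empirical_measure [simp]: "sets (empirical_measure z) = sets borel"
  unfolding empirical_measure_def by (metis sets.sets_measure_of_eq space_borel)

lemma emeasure_empirical_measure:
  assumes "A \<in> sets borel"
  shows "emeasure (empirical_measure z) A =
    ennreal (1 / real (length z)) * (\<Sum>j<length z. emeasure (return borel (z ! j)) A)"
proof (rule emeasure_measure_of[OF empirical_measure_def])
  show "countably_additive (sets (empirical_measure z))
     (\<lambda>A. ennreal (1 / real (length z)) * (\<Sum>j<length z. emeasure (return borel (z ! j)) A))"
  proof (rule countably_additiveI)
    fix F :: "nat \<Rightarrow> real set"
    assume F: "range F \<subseteq> sets (empirical_measure z)" "disjoint_family F"
    have "(\<Sum>i. \<Sum>j<length z. emeasure (return borel (z ! j)) (F i)) =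
          (\<Sum>j<length z. \<Sum>i. emeasure (return borel (z ! j)) (F i))"
      by (rule suminf_sum) simp
    also have "\<dots> = (\<Sum>j<length z. emeasure (return borel (z ! j)) (\<Union> (range F)))"
      using F by (intro sum.cong refl suminf_emeasure) auto
    finally show "(\<Sum>i. ennreal (1 / real (length z)) *
          (\<Sum>j<length z. emeasure (return borel (z ! j)) (F i))) =
        ennreal (1 / real (length z)) *
          (\<Sum>j<length z. emeasure (return borel (z ! j)) (\<Union> (range F)))"
      by simp
  qed
qed (use assms in \<open>auto simp: positive_def\<close>)

lemma real_distribution_empirical_measure:
  assumes "z \<noteq> []"
  shows "real_distribution (empirical_measure z)"
proof -
  have sp: "space (empirical_measure z) = UNIV"
    by (simp add: empirical_measure_def)
  have "emeasure (empirical_measure z) UNIV = ennreal (1 / real (length z)) * of_nat (length z)"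
    by (simp add: emeasure_empirical_measure)
  also have "\<dots> = 1"
    using assms by (simp add: ennreal_of_nat_eq_real_of_nat flip: ennreal_mult)
  finally show ?thesis
    by (simp add: real_distribution_def real_distribution_axioms_def prob_spaceI sp)
qed

definition levy_dist :: "real measure \<Rightarrow> real measure \<Rightarrow> real" where
  "levy_dist P Q =
     Inf {\<epsilon>. \<epsilon> > 0 \<and>
       (\<forall>x. cdf P (x - \<epsilon>) - \<epsilon> \<le> cdf Q x \<and> cdf Q x \<le> cdf P (x + \<epsilon>) + \<epsilon>)}"

end

theory Submission
  imports Defs
begin

text \<open>
  Let \<open>Z x\<close> and \<open>R x\<close> count the points and the roots that are at most \<open>x\<close>. Interlacing gives
  \<open>R x \<le> Z x \<le> R x + 1\<close>, and for generic \<open>x\<close> a parity argument yields \<open>R x = Z x - 1\<close> exactly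
  when \<open>(\<Sum>j. w j / (x - z j))\<close> is positive. This sum increases with each \<open>z j\<close> that does not cross
  \<open>x\<close>, so pushing the points to the right can only decrease \<open>R x\<close>. It does
  change the roots, because beyond all points the values of the polynomial strictly decrease. For equal weights the
  points may moreover be matched with a shift of indices by \<open>k\<close>: if \<open>z' j \<le> z (j + k) + e\<close> then the
  root counts satisfy \<open>R x \<le> R' (x + e) + k\<close>. With \<open>k = \<lfloor>n * e\<rfloor>\<close> this is the one-sided Levy
  condition for the roots, since \<open>k / (n - 1) \<le> n / (n - 1) * e\<close>.
\<close>

section \<open>Weighted sums of products of linear factors, and counting below a threshold\<close>

text \<open>Families over an arbitrary index set, rather than lists, allow an index to be deleted
  and a weight to be updated when coinciding points are merged.\<close>

definition family_poly :: "(nat \<Rightarrow> real) \<Rightarrow> (nat \<Rightarrow> real) \<Rightarrow> nat set \<Rightarrow> real poly" where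
  "family_poly w z I = (\<Sum>j\<in>I. smult (w j) (\<Prod>l\<in>I - {j}. [:- z l, 1:]))"

text \<open>The unnormalised distribution function of a finite multiset.\<close>

definition num_le :: "real multiset \<Rightarrow> real \<Rightarrow> nat" where
  "num_le M x = size {#y \<in># M. y \<le> x#}"

lemma num_le_empty [simp]: "num_le {#} x = 0"
  by (simp add: num_le_def)

lemma num_le_add_mset [simp]:
  "num_le (add_mset a M) x = (if a \<le> x then 1 else 0) + num_le M x"
  by (simp add: num_le_def)

lemma num_le_image_mset_set:
  "finite I \<Longrightarrow> num_le (image_mset f (mset_set I)) x = card {i \<in> I. f i \<le> x}"
  by (simp add: num_le_def filter_mset_image_mset filter_mset_mset_set)

lemma num_le_mono: "x \<le> x' \<Longrightarrow> num_le M x \<le> num_le M x'"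
  by (induction M) auto

lemma num_le_eq:
  assumes "x \<le> x'" and "\<And>y. y \<in># M \<Longrightarrow> y \<le> x' \<Longrightarrow> y \<le> x"
  shows "num_le M x' = num_le M x"
proof -
  have "{#y \<in># M. y \<le> x'#} = {#y \<in># M. y \<le> x#}"
    using assms by (intro filter_mset_cong refl) force
  then show ?thesis by (simp add: num_le_def)
qed

lemma poly_family_poly:
  "poly (family_poly w z I) x = (\<Sum>j\<in>I. w j * (\<Prod>l\<in>I - {j}. (x - z l)))"
  by (simp add: family_poly_def poly_sum poly_prod)

lemma poly_family_poly_at_point:
  assumes "finite I" "i \<in> I"
  shows "poly (family_poly w z I) (z i) = w i * (\<Prod>l\<in>I - {i}. (z i - z l))"
proof -
  have "(\<Prod>l\<in>I - {j}. (z i - z l)) = 0" if "j \<in> I - {i}" for j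
    using that assms by (intro prod_zero) auto
  then have "(\<Sum>j\<in>I - {i}. w j * (\<Prod>l\<in>I - {j}. (z i - z l))) = 0"
    by (intro sum.neutral) auto
  then show ?thesis
    by (simp add: poly_family_poly sum.remove[OF assms])
qed

text \<open>Dividing by the full product leaves a partial fraction sum, which for unit weights is
  the logarithmic derivative of that product.\<close>

lemma poly_family_poly_generic:
  assumes "finite I" "x \<notin> z ` I"
  shows "poly (family_poly w z I) x = (\<Sum>j\<in>I. w j / (x - z j)) * (\<Prod>l\<in>I. (x - z l))"
  unfolding poly_family_poly sum_distrib_right
proof (rule sum.cong)
  fix j assume "j \<in> I"
  then show "w j * (\<Prod>l\<in>I - {j}. (x - z l)) = w j / (x - z j) * (\<Prod>l\<in>I. (x - z l))"
    using assms by (auto simp: prod.remove[of I j])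
qed simp

lemma family_poly_coeffs:
  assumes "finite I"
  shows degree_family_poly_le: "degree (family_poly w z I) \<le> card I - 1"
    and coeff_family_poly: "coeff (family_poly w z I) (card I - 1) = sum w I"
proof -
  have deg: "degree (\<Prod>l\<in>I - {j}. [:- z l, 1:]) = card I - 1" if "j \<in> I" for j
    using that assms by (simp add: degree_prod_sum_eq)
  show "degree (family_poly w z I) \<le> card I - 1"
    unfolding family_poly_def using deg assms
    by (intro degree_sum_le) (auto intro: order_trans[OF degree_smult_le])
  have "coeff (\<Prod>l\<in>I - {j}. [:- z l, 1:]) (card I - 1) = 1" if "j \<in> I" for j
    using lead_coeff_prod[of "\<lambda>l. [:- z l, 1:]" "I - {j}"] deg[OF that] by simp
  then show "coeff (family_poly w z I) (card I - 1) = sum w I"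
    by (simp add: family_poly_def coeff_sum)
qed

text \<open>A double point gives every summand a common linear factor: those of \<open>i\<close> and
  \<open>j\<close> contain it once, the others twice. What remains is of the same kind with the two
  weights pooled, which permits induction on the number of points.\<close>

lemma family_poly_merge:
  assumes "finite I" "i \<in> I" "j \<in> I" "i \<noteq> j" "z i = z j"
  shows "family_poly w z I = [:- z j, 1:] * family_poly (w(j := w i + w j)) z (I - {i})"
proof -
  let ?L = "\<lambda>l. [:- z l, 1:]" and ?J = "I - {i} - {j}"
  have ij: "I = insert i (insert j ?J)" "finite ?J" "i \<notin> ?J" "j \<notin> ?J" "i \<notin> insert j ?J"
    using assms by auto
  have rest: "(\<Prod>l\<in>I - {k}. ?L l) = ?L j * (\<Prod>l\<in>I - {i} - {k}. ?L l)" if "k \<in> ?J" for k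
  proof -
    have "I - {k} = insert i (I - {i} - {k})" using that assms by auto
    then show ?thesis using assms by simp
  qed
  have A: "(\<Prod>l\<in>I - {i}. ?L l) = ?L j * (\<Prod>l\<in>?J. ?L l)"
    using assms by (subst prod.remove[of "I - {i}" j]) auto
  have B: "(\<Prod>l\<in>I - {j}. ?L l) = ?L j * (\<Prod>l\<in>?J. ?L l)"
  proof -
    have "I - {j} = insert i ?J" using assms by auto
    then show ?thesis using assms by simp
  qed
  have "family_poly w z I = smult (w i) (\<Prod>l\<in>I - {i}. ?L l) +
      (smult (w j) (\<Prod>l\<in>I - {j}. ?L l) + (\<Sum>k\<in>?J. smult (w k) (\<Prod>l\<in>I - {k}. ?L l)))"
    unfolding family_poly_def
    using assms by (subst sum.remove[of I i], simp, simp, subst sum.remove[of "I - {i}" j]) auto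
  also have "\<dots> = smult (w i) (?L j * (\<Prod>l\<in>?J. ?L l)) + (smult (w j) (?L j * (\<Prod>l\<in>?J. ?L l)) +
      (\<Sum>k\<in>?J. smult (w k) (?L j * (\<Prod>l\<in>I - {i} - {k}. ?L l))))"
    unfolding A B by (intro arg_cong2[where f = "(+)"] refl sum.cong) (simp only: rest)
  also have "\<dots> = ?L j * (smult (w i + w j) (\<Prod>l\<in>?J. ?L l) +
      (\<Sum>k\<in>?J. smult (w k) (\<Prod>l\<in>I - {i} - {k}. ?L l)))"
    by (simp only: distrib_left sum_distrib_left mult_smult_right smult_add_left add.assoc)
  also have "smult (w i + w j) (\<Prod>l\<in>?J. ?L l) +
      (\<Sum>k\<in>?J. smult (w k) (\<Prod>l\<in>I - {i} - {k}. ?L l)) =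
      family_poly (w(j := w i + w j)) z (I - {i})"
    unfolding family_poly_def
    using assms by (subst sum.remove[of "I - {i}" j]) (auto intro!: sum.cong)
  finally show ?thesis .
qed

section \<open>Interlacing of points and roots\<close>

text \<open>At consecutive points the polynomial takes values of opposite signs, so the intermediate
  value theorem puts a root into each gap.\<close>

lemma family_poly_distinct_roots:
  assumes I: "finite I" "I \<noteq> {}" and w: "\<And>i. i \<in> I \<Longrightarrow> w i > 0"
    and z: "strict_mono_on I z"
  shows "\<exists>y. \<forall>i\<in>I - {Max I}.
    poly (family_poly w z I) (y i) = 0 \<and> z i < y i \<and> (\<forall>j\<in>I. i < j \<longrightarrow> y i < z j)"
proof -
  let ?P = "family_poly w z I"
  have ex: "\<exists>y. poly ?P y = 0 \<and> z i < y \<and> (\<forall>j\<in>I. i < j \<longrightarrow> y < z j)"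
    if i: "i \<in> I - {Max I}" for i
  proof -
    \<comment> \<open>The successor of \<open>i\<close> in \<open>I\<close>, so that
      \<open>z s\<close> is the next point to the right of \<open>z i\<close>.\<close>
    define s where "s = Min {k\<in>I. i < k}"
    have "i < Max I" using I i by (metis Diff_iff Max_ge insertI1 order_less_le)
    then have ne: "{k\<in>I. i < k} \<noteq> {}" using I Max_in by blast
    have s: "s \<in> I" "i < s" using Min_in[OF _ ne] I by (auto simp: s_def)
    have s_le: "s \<le> k" if "k \<in> I" "i < k" for k
      using that I by (auto simp: s_def)
    have zs: "z i < z s" using z s i by (auto simp: strict_mono_on_def)
    let ?J = "I - {i} - {s}"
    \<comment> \<open>No further point lies between \<open>z i\<close> and \<open>z s\<close>, so
      both differences have the same sign.\<close>
    have pos: "(\<Prod>l\<in>?J. (z i - z l) * (z s - z l)) > 0"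
    proof (rule prod_pos)
      fix l assume l: "l \<in> ?J"
      then consider "l < i" | "s < l" using s_le by force
      then show "(z i - z l) * (z s - z l) > 0"
      proof cases
        case 1
        then have "z l < z i" using z l i by (auto simp: strict_mono_on_def)
        then show ?thesis using zs by simp
      next
        case 2
        then have "z s < z l" using z l s by (auto simp: strict_mono_on_def)
        then show ?thesis using zs by (simp add: mult_neg_neg)
      qed
    qed
    have "(\<Prod>l\<in>I - {i}. (z i - z l)) = (z i - z s) * (\<Prod>l\<in>?J. (z i - z l))"
      using I s by (subst prod.remove[of "I - {i}" s]) auto
    moreover have "(\<Prod>l\<in>I - {s}. (z s - z l)) = (z s - z i) * (\<Prod>l\<in>?J. (z s - z l))"
    proof -
      have "I - {s} = insert i ?J" using i s by auto
      then show ?thesis using I by simp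
    qed
    ultimately have "poly ?P (z i) * poly ?P (z s) =
        - (w i * w s * (z s - z i)^2 * (\<Prod>l\<in>?J. (z i - z l) * (z s - z l)))"
      using I i s
      by (simp only: poly_family_poly_at_point Diff_iff prod.distrib power2_eq_square) (simp add: algebra_simps)
    moreover have "w i * w s * (z s - z i)^2 * (\<Prod>l\<in>?J. (z i - z l) * (z s - z l)) > 0"
      using w i s zs pos by (intro mult_pos_pos) auto
    ultimately have "poly ?P (z i) * poly ?P (z s) < 0" by linarith
    from poly_IVT[OF zs this] obtain y where y: "z i < y" "y < z s" "poly ?P y = 0" by blast
    have "y < z j" if j: "j \<in> I" "i < j" for j
    proof -
      have "z s \<le> z j" using s_le[OF j] s j z
        by (metis less_eq_real_def order_le_less strict_mono_onD)
      then show ?thesis using y by simp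
    qed
    then show ?thesis using y by blast
  qed
  then show ?thesis by (intro bchoice) blast
qed

text \<open>The roots found in the gaps already number \<open>card I - 1\<close>, the degree bound,
  so they are all the roots and are simple.\<close>

lemma family_poly_interlacing_distinct:
  assumes I: "finite I" "I \<noteq> {}" and w: "\<And>i. i \<in> I \<Longrightarrow> w i > 0"
    and z: "strict_mono_on I z"
  shows "\<exists>M. family_poly w z I = smult (sum w I) (\<Prod>a\<in>#M. [:- a, 1:]) \<and> size M + 1 = card I \<and>
    (\<forall>x. num_le M x \<le> card {i\<in>I. z i \<le> x} \<and> card {i\<in>I. z i \<le> x} \<le> num_le M x + 1)"
proof -
  let ?P = "family_poly w z I" and ?J = "I - {Max I}"
  obtain y where y: "\<forall>i\<in>?J. poly ?P (y i) = 0 \<and> z i < y i \<and> (\<forall>j\<in>I. i < j \<longrightarrow> y i < z j)"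
    using family_poly_distinct_roots[of I w z] I w z by blast
  then have y0: "poly ?P (y i) = 0" and y1: "z i < y i" if "i \<in> ?J" for i
    using that by auto
  have y2: "y i < z j" if "i \<in> I" "j \<in> I" "i < j" for i j
  proof -
    have "i \<noteq> Max I" using that I by (metis Max_ge leD)
    then show ?thesis using y that by auto
  qed
  have less: "y i < y j" if "i \<in> ?J" "j \<in> ?J" "i < j" for i j
    using y1[OF that(2)] y2[of i j] that by auto
  then have inj: "inj_on y ?J"
    by (intro linorder_inj_onI') (metis less order_less_irrefl)
  have card: "card ?J = card I - 1" "card ?J + 1 = card I"
    using I by (auto simp: card_gt_0_iff)
  define M where "M = image_mset y (mset_set ?J)"
  have prodM: "(\<Prod>a\<in>#M. [:- a, 1:]) = (\<Prod>i\<in>?J. [:- y i, 1:])"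
    by (simp add: M_def prod_unfold_prod_mset image_mset.compositionality o_def)
  have deg: "degree (\<Prod>i\<in>?J. [:- y i, 1:]) = card I - 1"
    using I card by (simp add: degree_prod_sum_eq)
  \<comment> \<open>Both sides have degree at most \<open>card I - 1\<close>, the same coefficient
    there, and agree at the \<open>card I - 1\<close> distinct values of \<open>y\<close>.\<close>
  have "?P = smult (sum w I) (\<Prod>i\<in>?J. [:- y i, 1:])"
  proof (rule poly_eqI_degree_lead_coeff[where n = "card I - 1" and A = "y ` ?J"])
    show "coeff ?P (card I - 1) = coeff (smult (sum w I) (\<Prod>i\<in>?J. [:- y i, 1:])) (card I - 1)"
      using lead_coeff_prod[of "\<lambda>l. [:- y l, 1:]" ?J] deg coeff_family_poly[OF I(1)] by simp
    show "card I - 1 \<le> card (y ` ?J)" using card inj by (simp add: card_image)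
    show "degree ?P \<le> card I - 1" by (rule degree_family_poly_le[OF I(1)])
    show "degree (smult (sum w I) (\<Prod>i\<in>?J. [:- y i, 1:])) \<le> card I - 1"
      using deg degree_smult_le by metis
    fix v assume "v \<in> y ` ?J"
    then show "poly ?P v = poly (smult (sum w I) (\<Prod>i\<in>?J. [:- y i, 1:])) v"
      using y0 I by (auto simp: poly_prod)
  qed
  moreover have "size M + 1 = card I" using card by (simp add: M_def)
  moreover have "num_le M x \<le> card {i\<in>I. z i \<le> x} \<and> card {i\<in>I. z i \<le> x} \<le> num_le M x + 1" for x
  proof
    have num: "num_le M x = card {i\<in>?J. y i \<le> x}"
      using I by (simp add: M_def num_le_image_mset_set)
    show "num_le M x \<le> card {i\<in>I. z i \<le> x}"
      unfolding num
    proof (intro card_mono subsetI)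
      fix i assume "i \<in> {i\<in>?J. y i \<le> x}"
      then show "i \<in> {i\<in>I. z i \<le> x}" using y1[of i] by auto
    qed (use I in simp)
    let ?Z = "{i\<in>I. z i \<le> x}"
    show "card ?Z \<le> num_le M x + 1"
    proof (cases "?Z = {}")
      case False
      have m: "Max ?Z \<in> ?Z" using False I by (intro Max_in) auto
      \<comment> \<open>Apart from the last point up to \<open>x\<close>, each such point has its
        gap root to the left of that last point, hence below \<open>x\<close>.\<close>
      have "?Z - {Max ?Z} \<subseteq> {i\<in>?J. y i \<le> x}"
      proof
        fix i assume i: "i \<in> ?Z - {Max ?Z}"
        then have "i \<le> Max ?Z" using I by (intro Max_ge) auto
        then have "i < Max ?Z" using i by auto
        moreover have "Max ?Z \<le> Max I" using m I by (intro Max_ge) auto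
        ultimately show "i \<in> {i\<in>?J. y i \<le> x}" using y2[of i "Max ?Z"] i m by auto
      qed
      then have "card (?Z - {Max ?Z}) \<le> card {i\<in>?J. y i \<le> x}"
        using I by (intro card_mono) auto
      then show ?thesis using m I num by (simp add: card_Diff_singleton)
    next
      case True
      then show ?thesis by (simp only: card.empty)
    qed
  qed
  ultimately show ?thesis unfolding prodM[symmetric] by blast
qed

text \<open>Merging two coinciding points removes one point and one root at the same place, so both
  counts drop equally and the inequalities carry over from fewer points.\<close>

lemma family_poly_interlacing:
  assumes "finite I" "I \<noteq> {}" "\<And>i. i \<in> I \<Longrightarrow> w i > 0" "mono_on I z"
  shows "\<exists>M. family_poly w z I = smult (sum w I) (\<Prod>a\<in>#M. [:- a, 1:]) \<and> size M + 1 = card I \<and>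
    (\<forall>x. num_le M x \<le> card {i\<in>I. z i \<le> x} \<and> card {i\<in>I. z i \<le> x} \<le> num_le M x + 1)"
  using assms
\<comment> \<open>The weights are generalised because merging changes one of them.\<close>
proof (induction "card I" arbitrary: I w rule: less_induct)
  case less
  note I = less.prems(1,2) and w = less.prems(3) and z = less.prems(4)
  show ?case
  proof (cases "inj_on z I")
    case True
    then have "strict_mono_on I z"
      using z by (auto simp: strict_mono_on_def mono_on_def inj_on_def order_less_le)
    then show ?thesis by (intro family_poly_interlacing_distinct I w)
  next
    case False
    then obtain i j where ij: "i \<in> I" "j \<in> I" "i \<noteq> j" "z i = z j"
      by (auto simp: inj_on_def)
    let ?w = "w(j := w i + w j)" and ?I = "I - {i}"
    have "card ?I < card I" using I ij by (intro psubset_card_mono) auto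
    moreover have "?w k > 0" if "k \<in> ?I" for k
      using that w ij by (auto intro: add_pos_pos)
    moreover have "mono_on ?I z" using z by (rule mono_on_subset) auto
    moreover have "?I \<noteq> {}" using ij by auto
    ultimately obtain M where M:
      "family_poly ?w z ?I = smult (sum ?w ?I) (\<Prod>a\<in>#M. [:- a, 1:])" "size M + 1 = card ?I"
      "\<And>x. num_le M x \<le> card {k\<in>?I. z k \<le> x} \<and> card {k\<in>?I. z k \<le> x} \<le> num_le M x + 1"
      using less.hyps[of ?I ?w] I by auto
    have "sum ?w ?I = sum w I"
      using I ij by (simp add: sum.remove[of I i] sum.remove[of "I - {i}" j])
    then have "family_poly w z I = smult (sum w I) (\<Prod>a\<in>#add_mset (z j) M. [:- a, 1:])"
      using family_poly_merge[OF I(1) ij, of w] M(1) by simp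
    moreover have "size (add_mset (z j) M) + 1 = card I"
      using M(2) I ij by (simp add: card_Suc_Diff1)
    moreover have "card {k\<in>I. z k \<le> x} = (if z j \<le> x then 1 else 0) + card {k\<in>?I. z k \<le> x}" for x
    proof -
      have "{k\<in>I. z k \<le> x} = (if z j \<le> x then insert i else id) {k\<in>?I. z k \<le> x}"
        using ij by auto
      then show ?thesis using I by simp
    qed
    ultimately show ?thesis using M(3) by (intro exI[of _ "add_mset (z j) M"]) auto
  qed
qed

text \<open>A nonzero constant times a product of linear factors determines its multiset of roots,
  so the multiset given by interlacing is \<open>proots\<close>.\<close>

lemma proots_family_poly:
  assumes I: "finite I" "I \<noteq> {}" and w: "\<And>i. i \<in> I \<Longrightarrow> w i > 0" and z: "mono_on I z"
  shows family_poly_eq_prod_proots: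
      "family_poly w z I = smult (sum w I) (\<Prod>a\<in>#proots (family_poly w z I). [:- a, 1:])"
    and size_proots_family_poly: "size (proots (family_poly w z I)) + 1 = card I"
    and num_le_proots_le: "num_le (proots (family_poly w z I)) x \<le> card {i\<in>I. z i \<le> x}"
    and num_le_proots_ge: "card {i\<in>I. z i \<le> x} \<le> num_le (proots (family_poly w z I)) x + 1"
proof -
  obtain M where M: "family_poly w z I = smult (sum w I) (\<Prod>a\<in>#M. [:- a, 1:])" "size M + 1 = card I"
    "\<And>x. num_le M x \<le> card {i\<in>I. z i \<le> x} \<and> card {i\<in>I. z i \<le> x} \<le> num_le M x + 1"
    using family_poly_interlacing[of I w z] assms by blast
  have "sum w I > 0" using I w by (intro sum_pos)
  then have "proots (family_poly w z I) = proots (\<Prod>a\<in>#M. [:- a, 1:])"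
    using M(1) by simp
  also have "\<dots> = M"
  proof (induction M)
    case (add a M)
    have "(\<Prod>a\<in>#M. [:- a, 1:]) \<noteq> 0" by (auto simp: prod_mset_zero_iff)
    then show ?case
      using add proots_mult[of "[:- a, 1:]" "\<Prod>a\<in>#M. [:- a, 1:]"] by (simp del: mult_pCons_left)
  qed simp
  finally have "proots (family_poly w z I) = M" .
  then show "family_poly w z I = smult (sum w I) (\<Prod>a\<in>#proots (family_poly w z I). [:- a, 1:])"
    "size (proots (family_poly w z I)) + 1 = card I"
    "num_le (proots (family_poly w z I)) x \<le> card {i\<in>I. z i \<le> x}"
    "card {i\<in>I. z i \<le> x} \<le> num_le (proots (family_poly w z I)) x + 1"
    using M by simp_all
qed

section \<open>The exact root count from signs\<close>

text \<open>Each entry beyond \<open>x\<close> contributes one sign change; their number has the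
  parity of \<open>size M + num_le M x\<close>.\<close>

lemma sgn_prod_mset_diff:
  fixes x :: real
  assumes "x \<notin># M"
  shows "sgn (\<Prod>a\<in>#M. (x - a)) = (- 1) ^ size M * (- 1) ^ num_le M x"
  using assms by (induction M) (auto simp: sgn_mult)

text \<open>
  With \<open>f = (\<Sum>i\<in>I. w i / (x - z i))\<close>, comparing the signs of both sides of
  \<open>family_poly w z I = f * (\<Prod>i\<in>I. x - z i)\<close> decides which of the two values allowed
  by interlacing is taken.
\<close>

lemma num_le_proots_generic:
  assumes I: "finite I" "I \<noteq> {}" and w: "\<And>i. i \<in> I \<Longrightarrow> w i > 0" and z: "mono_on I z"
    and x: "x \<notin> z ` I" "x \<notin># proots (family_poly w z I)"
  shows "card {i\<in>I. z i \<le> x} =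
    num_le (proots (family_poly w z I)) x + (if (\<Sum>i\<in>I. w i / (x - z i)) > 0 then 1 else 0)"
proof -
  define R where "R = proots (family_poly w z I)"
  define Z where "Z = image_mset z (mset_set I)"
  define f where "f = (\<Sum>i\<in>I. w i / (x - z i))"
  have W: "sum w I > 0" using I w by (intro sum_pos)
  have Z: "num_le Z x = card {i\<in>I. z i \<le> x}" "size Z = card I"
    using I by (simp_all add: Z_def num_le_image_mset_set)
  have "x \<notin># Z" using x I by (simp add: Z_def)
  have "poly (family_poly w z I) x = sum w I * (\<Prod>a\<in>#R. (x - a))"
    unfolding R_def
    by (subst family_poly_eq_prod_proots[OF I w z])
       (simp_all add: poly_prod_mset image_mset.compositionality o_def)
  moreover have "poly (family_poly w z I) x = f * (\<Prod>a\<in>#Z. (x - a))"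
    using poly_family_poly_generic[OF I(1) x(1), of w]
    by (simp add: f_def Z_def prod_unfold_prod_mset image_mset.compositionality o_def)
  ultimately have "f * (\<Prod>a\<in>#Z. (x - a)) = sum w I * (\<Prod>a\<in>#R. (x - a))" by simp
  then have "sgn f * sgn (\<Prod>a\<in>#Z. (x - a)) = sgn (\<Prod>a\<in>#R. (x - a))"
    using W by (metis sgn_mult sgn_pos mult_1)
  then have sgn: "sgn f * ((- 1) ^ size Z * (- 1) ^ num_le Z x) = (- 1) ^ size R * (- 1) ^ num_le R x"
    using sgn_prod_mset_diff[OF \<open>x \<notin># Z\<close>] sgn_prod_mset_diff[of x R] x(2) by (simp add: R_def)
  have size: "size Z = Suc (size R)"
    using size_proots_family_poly[OF I w z] Z(2) by (simp add: R_def)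
  have "num_le R x \<le> num_le Z x" "num_le Z x \<le> num_le R x + 1"
    using num_le_proots_le[OF I w z] num_le_proots_ge[OF I w z] Z(1) by (simp_all add: R_def)
  \<comment> \<open>There is one more point than roots, so the sign identity gives
    \<open>sgn f = - 1\<close> if the counts agree and \<open>sgn f = 1\<close> if they differ by
    one.\<close>
  then consider "num_le Z x = num_le R x" | "num_le Z x = Suc (num_le R x)" by linarith
  then have "num_le Z x = num_le R x + (if f > 0 then 1 else 0)"
  proof cases
    case 1
    then show ?thesis using sgn by (auto simp: size sgn_if split: if_splits)
  next
    case 2
    then show ?thesis using sgn by (auto simp: size sgn_if split: if_splits)
  qed
  then show ?thesis by (simp add: Z(1) R_def f_def)
qed

text \<open>
  The case \<open>k = 0\<close>, \<open>e = 0\<close> is monotonicity in the points; the shift \<open>k\<close> is what the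
  Levy metric needs, and it forces the weights to be \<open>k\<close>-periodic.
\<close>

lemma num_le_proots_shift:
  fixes w z z' :: "nat \<Rightarrow> real"
  assumes n: "n > 0" and w: "\<And>i. i < n \<Longrightarrow> w i > 0"
    and z: "mono_on {..<n} z" and z': "mono_on {..<n} z'"
    and le: "\<And>j. j + k < n \<Longrightarrow> z' j \<le> z (j + k) + e"
    and per: "\<And>j. j + k < n \<Longrightarrow> w j = w (j + k)"
  shows "num_le (proots (family_poly w z {..<n})) x
    \<le> num_le (proots (family_poly w z' {..<n})) (x + e) + k"
proof -
  define R where "R = proots (family_poly w z {..<n})"
  define R' where "R' = proots (family_poly w z' {..<n})"
  \<comment> \<open>All thresholds at which one of the counts can jump, those of the primed data
    being translated by \<open>- e\<close>.\<close>
  define T where "T = set_mset R \<union> z ` {..<n} \<union> (\<lambda>s. s - e) ` (set_mset R' \<union> z' ` {..<n})"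
  have ne: "finite {..<n}" "{..<n} \<noteq> {}" and w0: "\<And>i. i \<in> {..<n} \<Longrightarrow> w i > 0" using n w by auto
  have "finite T" by (simp add: T_def)
  then obtain d where d: "d > 0" "\<And>s. s \<in> T \<Longrightarrow> s \<noteq> x \<Longrightarrow> d \<le> dist x s"
    using finite_set_avoid by metis
  \<comment> \<open>Counts are right-continuous step functions, so moving slightly to the right of
    \<open>x\<close> makes the threshold generic without changing the root counts.\<close>
  define t where "t = x + d / 2"
  have t: "x < t" using d by (simp add: t_def)
  have T: "s < x \<or> s = x \<or> t < s" if "s \<in> T" for s
    using d that by (force simp: t_def dist_real_def)
  have tR: "num_le R t = num_le R x"
  proof (rule num_le_eq)
    fix y assume "y \<in># R" "y \<le> t"
    then show "y \<le> x" using T[of y] by (auto simp: T_def)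
  qed (use t in simp)
  have tR': "num_le R' (t + e) = num_le R' (x + e)"
  proof (rule num_le_eq)
    fix y assume y: "y \<in># R'" "y \<le> t + e"
    then have "y - e \<in> T" by (auto simp: T_def)
    then show "y \<le> x + e" using T[of "y - e"] y by auto
  qed (use t in simp)
  have "t \<notin> T" using T[of t] t by auto
  then have tz: "t \<notin> z ` {..<n}" "t \<notin># R"
    and "t \<notin> (\<lambda>s. s - e) ` (set_mset R' \<union> z' ` {..<n})"
    unfolding T_def by blast+
  then have tz': "t + e \<notin> z' ` {..<n}" "t + e \<notin># R'"
    by (force simp: image_iff)+
  define A where "A = {i\<in>{..<n}. z i \<le> t}"
  define A' where "A' = {i\<in>{..<n}. z' i \<le> t + e}"
  define f where "f = (\<Sum>i\<in>{..<n}. w i / (t - z i))"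
  define f' where "f' = (\<Sum>i\<in>{..<n}. w i / (t + e - z' i))"
  have A: "card A = num_le R t + (if f > 0 then 1 else 0)"
    using num_le_proots_generic[OF ne w0 z] tz by (simp add: A_def R_def f_def)
  have A': "card A' = num_le R' (t + e) + (if f' > 0 then 1 else 0)"
    using num_le_proots_generic[OF ne w0 z'] tz' by (simp add: A'_def R'_def f'_def)
  \<comment> \<open>By \<open>le\<close>, an index of \<open>A\<close> is either among the first
    \<open>k\<close> or a shift by \<open>k\<close> of an index of \<open>A'\<close>.\<close>
  define U where "U = {..<k} \<union> (\<lambda>j. j + k) ` A'"
  have AU: "A \<subseteq> U"
  proof
    fix i assume i: "i \<in> A"
    show "i \<in> U"
    proof (cases "i < k")
      case False
      then have "i - k \<in> A'" using i le[of "i - k"] by (auto simp: A_def A'_def)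
      then show ?thesis using False by (force simp: U_def)
    qed (simp add: U_def)
  qed
  have finU: "finite U" by (simp add: U_def A'_def)
  have cardU: "card U \<le> k + card A'"
    unfolding U_def by (intro order_trans[OF card_Un_le]) (simp add: card_image)
  have "num_le R t \<le> num_le R' (t + e) + k"
  \<comment> \<open>A strict inequality absorbs the one unit by which \<open>card A'\<close> may
    exceed its root count. Equality forces \<open>A = U\<close>, and then \<open>f' > 0\<close> must
    be shown to imply \<open>f > 0\<close>.\<close>
  proof (cases "card A < k + card A'")
    case True
    then show ?thesis using A A' by (auto split: if_splits)
  next
    case False
    then have "A = U" using AU finU cardU by (intro card_seteq) auto
    \<comment> \<open>Term \<open>i\<close> of \<open>f'\<close> is compared with term
      \<open>i + k\<close> of \<open>f\<close>. Unpaired terms are nonpositive in \<open>f'\<close>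
      and nonnegative in \<open>f\<close>, so dropping them is harmless.\<close>
    have "f' \<le> f"
    proof -
      have neg: "w i / (t + e - z' i) \<le> 0" if "i < n" "\<not> i + k < n" for i
      proof -
        have "i \<notin> A'" using that \<open>A = U\<close> by (force simp: A_def U_def)
        then show ?thesis using that w[of i] by (simp add: A'_def divide_le_0_iff)
      qed
      have pos: "w i / (t - z i) \<ge> 0" if "i < n" "i < k" for i
      proof -
        have "i \<in> A" using that \<open>A = U\<close> by (simp add: U_def)
        then show ?thesis using that w[of i] by (simp add: A_def)
      qed
      \<comment> \<open>Since \<open>A = U\<close>, both points lie on the same side of their
        thresholds; the denominators have equal sign and the reciprocal is decreasing there.\<close>
      have mid: "w i / (t + e - z' i) \<le> w (i + k) / (t - z (i + k))" if "i + k < n" for i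
      proof (cases "i \<in> A'")
        case True
        then have "i + k \<in> A" using \<open>A = U\<close> by (simp add: U_def)
        then have "t - z (i + k) > 0" using tz that by (force simp: A_def)
        then show ?thesis using le[OF that] per[OF that] w[OF that]
          by (intro frac_le) auto
      next
        case False
        then have "i + k \<notin> A" using \<open>A = U\<close> by (auto simp: U_def)
        then have "t - z (i + k) < 0" "t + e - z' i < 0" using False that by (auto simp: A_def A'_def)
        then show ?thesis using le[OF that] per[OF that] w[OF that]
          by (simp add: divide_left_mono mult_neg_neg)
      qed
      have "f' \<le> (\<Sum>i\<in>{i. i + k < n}. w i / (t + e - z' i))"
      proof -
        have "(\<Sum>i\<in>{..<n} - {i. i + k < n}. w i / (t + e - z' i)) \<le> 0"
          using neg by (intro sum_nonpos) auto
        moreover have "f' = (\<Sum>i\<in>{..<n} - {i. i + k < n}. w i / (t + e - z' i)) +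
            (\<Sum>i\<in>{i. i + k < n}. w i / (t + e - z' i))"
          unfolding f'_def by (rule sum.subset_diff) auto
        ultimately show ?thesis by simp
      qed
      also have "\<dots> \<le> (\<Sum>i\<in>{i. i + k < n}. w (i + k) / (t - z (i + k)))"
        using mid by (intro sum_mono) auto
      also have "\<dots> = (\<Sum>i\<in>{k..<n}. w i / (t - z i))"
        by (rule sum.reindex_bij_witness[of _ "\<lambda>i. i - k" "\<lambda>i. i + k"]) auto
      also have "\<dots> \<le> f"
        unfolding f_def using pos by (intro sum_mono2) auto
      finally show ?thesis .
    qed
    then show ?thesis using A A' False cardU AU card_mono[OF finU AU] by (auto split: if_splits)
  qed
  then show ?thesis using tR tR' by (simp add: R_def R'_def)
qed

section \<open>From counts to sorted lists\<close>

lemma num_le_mset: "num_le (mset ys) x = card {j. j < length ys \<and> ys ! j \<le> x}"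
  by (simp add: num_le_def length_filter_conv_card flip: mset_filter)

text \<open>At least \<open>j + k + 1\<close> entries of \<open>ys\<close> are at most
  \<open>ys ! (j + k)\<close>, so at least \<open>j + 1\<close> entries of \<open>ys'\<close> are at
  most that value plus \<open>e\<close>; in a sorted list this bounds the entry with index
  \<open>j\<close>.\<close>

lemma nth_le_of_num_le:
  assumes "sorted ys" "sorted ys'" and num: "num_le (mset ys) (ys ! (j + k)) \<le> num_le (mset ys') (ys ! (j + k) + e) + k"
    and j: "j + k < length ys" "j < length ys'"
  shows "ys' ! j \<le> ys ! (j + k) + e"
proof (rule ccontr)
  assume *: "\<not> ys' ! j \<le> ys ! (j + k) + e"
  have "i < j" if "i < length ys'" "ys' ! i \<le> ys ! (j + k) + e" for i
    using * sorted_nth_mono[OF assms(2), of j i] that by force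
  then have "{i. i < length ys' \<and> ys' ! i \<le> ys ! (j + k) + e} \<subseteq> {..<j}" by auto
  then have "num_le (mset ys') (ys ! (j + k) + e) \<le> j"
    using card_mono[of "{..<j}"] by (force simp: num_le_mset)
  moreover have "{..j + k} \<subseteq> {i. i < length ys \<and> ys ! i \<le> ys ! (j + k)}"
    using sorted_nth_mono[OF assms(1)] j by auto
  then have "num_le (mset ys) (ys ! (j + k)) \<ge> j + k + 1"
    using card_mono[of "{i. i < length ys \<and> ys ! i \<le> ys ! (j + k)}" "{..j + k}"]
    by (simp add: num_le_mset)
  ultimately show False using num by simp
qed

section \<open>The root map: range and strict monotonicity\<close>

lemma weighted_poly_eq_family_poly:
  "length z = n \<Longrightarrow> weighted_poly w z = family_poly ((!) w) ((!) z) {..<n}"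
  by (simp add: weighted_poly_def family_poly_def)

lemma mset_root_map [simp]: "mset (root_map w z) = proots (weighted_poly w z)"
  by (simp add: root_map_def)

lemma sorted_root_map [simp]: "sorted (root_map w z)"
  by (simp add: root_map_def)

lemma mono_on_nth: "z \<in> Delta n \<Longrightarrow> mono_on {..<n} ((!) z)"
  by (auto simp: Delta_def mono_on_def sorted_nth_mono)

lemma root_map_in_Delta:
  assumes "n > 0" "\<And>j. j < n \<Longrightarrow> w ! j > 0" "z \<in> Delta n"
  shows "root_map w z \<in> Delta (n - 1)"
proof -
  have "size (proots (weighted_poly w z)) + 1 = n"
    using size_proots_family_poly[of "{..<n}" "(!) w" "(!) z"] assms mono_on_nth[OF assms(3)]
    by (auto simp: Delta_def weighted_poly_eq_family_poly[of z n])
  then have "length (root_map w z) = n - 1"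
    using mset_root_map[of w z] by (metis add_diff_cancel_right' size_mset)
  then show ?thesis by (simp add: Delta_def)
qed

lemma num_le_root_map_shift:
  assumes "n > 0" "\<And>j. j < n \<Longrightarrow> w ! j > 0" "z \<in> Delta n" "z' \<in> Delta n"
    and "\<And>j. j + k < n \<Longrightarrow> z' ! j \<le> z ! (j + k) + e"
    and "\<And>j. j + k < n \<Longrightarrow> w ! j = w ! (j + k)"
  shows "num_le (mset (root_map w z)) x \<le> num_le (mset (root_map w z')) (x + e) + k"
  using num_le_proots_shift[of n "(!) w" "(!) z" "(!) z'" k e x] assms
    mono_on_nth[OF assms(3)] mono_on_nth[OF assms(4)]
  by (simp add: Delta_def weighted_poly_eq_family_poly[of _ n])

lemma root_map_mono:
  assumes "n > 0" "\<And>j. j < n \<Longrightarrow> w ! j > 0" "z \<in> Delta n" "z' \<in> Delta n" "coord_le z z'"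
  shows "coord_le (root_map w z) (root_map w z')"
proof -
  have "z ! j \<le> z' ! j" if "j < n" for j
    using assms that by (auto simp: coord_le_def list_all2_conv_all_nth Delta_def)
  \<comment> \<open>The two lists trade places: points further right leave fewer roots up to
    \<open>x\<close>.\<close>
  then have num: "num_le (mset (root_map w z')) x \<le> num_le (mset (root_map w z)) x" for x
    using num_le_root_map_shift[OF assms(1,2,4,3), of 0 0 x] by simp
  have len: "length (root_map w z) = n - 1" "length (root_map w z') = n - 1"
    using root_map_in_Delta[of n w] assms by (auto simp: Delta_def)
  have "root_map w z ! j \<le> root_map w z' ! j" if "j < n - 1" for j
    using nth_le_of_num_le[of "root_map w z'" "root_map w z" j 0 0] num len that by simp
  then show ?thesis using len by (simp add: coord_le_def list_all2_conv_all_nth)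
qed

text \<open>Equal roots and the common leading coefficient, the sum of the weights, would make the
  polynomials equal. To the right of all points, however, moving a point to the right lowers the
  value.\<close>

lemma root_map_strict:
  assumes n: "n \<ge> 2" and w: "\<And>j. j < n \<Longrightarrow> w ! j > 0" and z: "z \<in> Delta n" and z': "z' \<in> Delta n"
    and le: "coord_le z z'" and "z \<noteq> z'"
  shows "root_map w z \<noteq> root_map w z'"
proof
  assume eq: "root_map w z = root_map w z'"
  have len: "length z = n" "length z' = n" using z z' by (auto simp: Delta_def)
  have I: "finite {..<n}" "{..<n} \<noteq> {}" "\<And>j. j \<in> {..<n} \<Longrightarrow> w ! j > 0"
    using n w by (auto simp: lessThan_empty_iff)
  have zz': "z ! j \<le> z' ! j" if "j < n" for j
    using le that len by (auto simp: coord_le_def list_all2_conv_all_nth)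
  obtain i where i: "i < n" "z ! i < z' ! i"
    using \<open>z \<noteq> z'\<close> len zz' by (metis nth_equalityI order_less_le)
  \<comment> \<open>The summand of \<open>j\<close> contains the factor of the moved point
    \<open>i\<close>, so it drops strictly; such a \<open>j\<close> exists because
    \<open>n \<ge> 2\<close>.\<close>
  obtain j where j: "j < n" "j \<noteq> i"
  proof (cases "i = 0")
    case True then show ?thesis using that[of 1] n by simp
  next
    case False then show ?thesis using that[of 0] n by simp
  qed
  have "proots (weighted_poly w z) = proots (weighted_poly w z')"
    using eq by (metis mset_root_map)
  then have polys: "family_poly ((!) w) ((!) z) {..<n} = family_poly ((!) w) ((!) z') {..<n}"
    using family_poly_eq_prod_proots[where w = "(!) w", OF I mono_on_nth[OF z]]
      family_poly_eq_prod_proots[where w = "(!) w", OF I mono_on_nth[OF z']] len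
    by (simp add: weighted_poly_eq_family_poly[of _ n])
  \<comment> \<open>Beyond the largest point of \<open>z'\<close>, hence beyond those of
    \<open>z\<close> too, so all factors are positive.\<close>
  define x where "x = z' ! (n - 1) + 1"
  have x: "z' ! l < x" if "l < n" for l
    using sorted_nth_mono[of z' l "n - 1"] z' that by (force simp: x_def Delta_def)
  let ?F = "\<lambda>u k. w ! k * (\<Prod>l\<in>{..<n} - {k}. (x - u ! l))"
  have "sum (?F z') {..<n} < sum (?F z) {..<n}"
  proof (rule sum_strict_mono_ex1)
    show "\<forall>k\<in>{..<n}. ?F z' k \<le> ?F z k"
      using x zz' w by (intro ballI mult_left_mono prod_mono) (auto intro: less_imp_le)
    have "(\<Prod>l\<in>{..<n} - {j}. (x - z' ! l)) < (\<Prod>l\<in>{..<n} - {j}. (x - z ! l))"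
    proof (rule prod_mono_strict[of i])
      fix l assume "l \<in> {..<n} - {j}"
      then show "0 \<le> x - z' ! l \<and> x - z' ! l \<le> x - z ! l" "0 < x - z ! l"
        using x[of l] zz'[of l] by auto
    qed (use i j in auto)
    then show "\<exists>k\<in>{..<n}. ?F z' k < ?F z k"
      using j w by (intro bexI[of _ j]) auto
  qed simp
  then show False
    using polys poly_family_poly[of "(!) w" "(!) z" "{..<n}" x]
      poly_family_poly[of "(!) w" "(!) z'" "{..<n}" x] by simp
qed

section \<open>The Lipschitz bound for the Levy metric\<close>

lemma cdf_empirical_measure:
  "cdf (empirical_measure z) x = real (num_le (mset z) x) / real (length z)"
proof -
  have "(\<Sum>j<length z. emeasure (return borel (z ! j)) {..x}) =
      (\<Sum>j<length z. ennreal (if z ! j \<le> x then 1 else 0))"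
    by (intro sum.cong) (auto simp: indicator_def)
  also have "\<dots> = ennreal (\<Sum>j<length z. if z ! j \<le> x then 1 else 0)"
    by (intro sum_ennreal) auto
  also have "(\<Sum>j<length z. if z ! j \<le> x then 1 else 0 :: real) = real (num_le (mset z) x)"
    by (simp add: num_le_mset sum.If_cases Int_def)
  finally have "emeasure (empirical_measure z) {..x} =
      ennreal (1 / real (length z) * real (num_le (mset z) x))"
    by (simp add: emeasure_empirical_measure flip: ennreal_mult)
  then show ?thesis by (simp add: cdf_def measure_def)
qed

text \<open>One of the two inequalities in the Levy condition; the other follows by exchanging
  \<open>z\<close> and \<open>z'\<close>.\<close>

lemma cdf_root_map_le:
  assumes n: "n \<ge> 2" and w: "\<And>j. j < n \<Longrightarrow> w ! j > 0"
    and const: "\<forall>i<n. \<forall>j<n. w ! i = w ! j" and z: "z \<in> Delta n" and z': "z' \<in> Delta n"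
    and "e > 0" and cdf: "\<And>x. cdf (empirical_measure z) x \<le> cdf (empirical_measure z') (x + e) + e"
    and c: "c = real n / (real n - 1) * e"
  shows "cdf (empirical_measure (root_map w z)) x \<le> cdf (empirical_measure (root_map w z')) (x + c) + c"
proof -
  have len: "length z = n" "length z' = n" using z z' by (auto simp: Delta_def)
  have lenr: "length (root_map w z) = n - 1" "length (root_map w z') = n - 1"
    using root_map_in_Delta[of n w] n w z z' by (auto simp: Delta_def)
  \<comment> \<open>Counts are integers, so the slack \<open>n * e\<close> between them can be
    rounded down.\<close>
  define k where "k = nat \<lfloor>real n * e\<rfloor>"
  have "real k \<le> real n * e" using \<open>e > 0\<close> by (simp add: k_def)
  have count: "num_le (mset z) x \<le> num_le (mset z') (x + e) + k" for x
  proof -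
    have "real (num_le (mset z) x) \<le> real (num_le (mset z') (x + e)) + real n * e"
      using cdf[of x] n len by (simp add: cdf_empirical_measure field_simps)
    then show ?thesis unfolding k_def by linarith
  qed
  have "z' ! j \<le> z ! (j + k) + e" if "j + k < n" for j
    using nth_le_of_num_le[of z z' j k e] count z z' that by (auto simp: Delta_def)
  then have "num_le (mset (root_map w z)) x \<le> num_le (mset (root_map w z')) (x + e) + k"
  proof (intro num_le_root_map_shift[of n])
    show "w ! j = w ! (j + k)" if "j + k < n" for j
      using const that by (meson add_lessD1)
  qed (use n w z z' in auto)
  also have "num_le (mset (root_map w z')) (x + e) \<le> num_le (mset (root_map w z')) (x + c)"
  proof -
    have "e \<le> c" using n \<open>e > 0\<close> by (simp add: c field_simps)
    then show ?thesis
      by (intro num_le_mono) simp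
  qed
  finally have "real (num_le (mset (root_map w z)) x) \<le>
      real (num_le (mset (root_map w z')) (x + c)) + real n * e"
    using \<open>real k \<le> real n * e\<close> by linarith
  \<comment> \<open>The same slack is now divided by \<open>n - 1\<close> roots instead of
    \<open>n\<close> points, which produces the Lipschitz constant.\<close>
  also have "real n * e = c * real (n - 1)" using n by (simp add: c of_nat_diff)
  finally show ?thesis
    using n lenr by (simp add: cdf_empirical_measure pos_divide_le_eq distrib_right)
qed

text \<open>Multiplication by \<open>n / (n - 1)\<close> sends admissible radii for the points to
  admissible radii for the roots; passing to infima gives the bound.\<close>

lemma levy_root_map_le:
  assumes n: "n \<ge> 2" and w: "\<And>j. j < n \<Longrightarrow> w ! j > 0"
    and const: "\<forall>i<n. \<forall>j<n. w ! i = w ! j" and z: "z \<in> Delta n" and z': "z' \<in> Delta n"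
  shows "levy_dist (empirical_measure (root_map w z)) (empirical_measure (root_map w z'))
    \<le> real n / (real n - 1) * levy_dist (empirical_measure z) (empirical_measure z')"
proof -
  define S where "S P Q = {e. e > 0 \<and> (\<forall>x. cdf P (x - e) - e \<le> cdf Q x \<and> cdf Q x \<le> cdf P (x + e) + e)}"
    for P Q :: "real measure"
  let ?c = "real n / (real n - 1)"
  let ?P = "empirical_measure z" and ?Q = "empirical_measure z'"
  let ?P' = "empirical_measure (root_map w z)" and ?Q' = "empirical_measure (root_map w z')"
  have c: "?c > 0" using n by simp
  have bdd: "bdd_below (S P Q)" for P Q by (auto simp: S_def intro: bdd_belowI[of _ 0])
  have scale: "?c * e \<in> S ?P' ?Q'" if e: "e \<in> S ?P ?Q" for e
  proof -
    have e0: "e > 0" and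
      e1: "cdf ?P (x - e) - e \<le> cdf ?Q x" and e2: "cdf ?Q x \<le> cdf ?P (x + e) + e" for x
      using e by (auto simp: S_def)
    \<comment> \<open>The lower Levy inequality, translated by \<open>e\<close>, is the upper one
      with the measures exchanged.\<close>
    have "cdf ?P x \<le> cdf ?Q (x + e) + e" for x using e1[of "x + e"] by simp
    from cdf_root_map_le[OF n w const z z' e0 this refl]
    have A: "cdf ?P' x \<le> cdf ?Q' (x + ?c * e) + ?c * e" for x by blast
    from cdf_root_map_le[OF n w const z' z e0 e2 refl]
    have B: "cdf ?Q' x \<le> cdf ?P' (x + ?c * e) + ?c * e" for x by blast
    have "cdf ?P' (x - ?c * e) - ?c * e \<le> cdf ?Q' x" for x
      using A[of "x - ?c * e"] by simp
    moreover have "?c * e > 0" using c e0 by (rule mult_pos_pos)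
    ultimately show ?thesis using B unfolding S_def by blast
  qed
  \<comment> \<open>Distribution functions lie between 0 and 1, so the radius 1 always works; the
    infimum is thus over a nonempty set.\<close>
  have "1 \<in> S ?P ?Q"
  proof -
    have "real_distribution ?P" "real_distribution ?Q"
      using n z z' by (auto intro!: real_distribution_empirical_measure simp: Delta_def)
    then have "0 \<le> cdf ?P x" "cdf ?P x \<le> 1" "0 \<le> cdf ?Q x" "cdf ?Q x \<le> 1" for x
      by (simp_all add: real_distribution.cdf_bounded_prob) (simp_all add: cdf_def)
    then show ?thesis by (simp add: S_def) (smt (verit))
  qed
  have "Inf (S ?P' ?Q') / ?c \<le> Inf (S ?P ?Q)"
  proof (rule cInf_greatest)
    fix e assume "e \<in> S ?P ?Q"
    then have "Inf (S ?P' ?Q') \<le> ?c * e" by (intro cInf_lower scale bdd)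
    then show "Inf (S ?P' ?Q') / ?c \<le> e" using c by (simp only: pos_divide_le_eq mult.commute)
  qed (use \<open>1 \<in> S ?P ?Q\<close> in blast)
  then have "Inf (S ?P' ?Q') \<le> ?c * Inf (S ?P ?Q)" using c by (simp only: pos_divide_le_eq mult.commute)
  then show ?thesis by (simp only: levy_dist_def S_def)
qed

theorem theorem2p1:
  fixes n :: nat and w :: "real list"
  assumes "n \<ge> 2" and "length w = n" and "\<forall>j<n. w ! j > 0"
  shows "root_map w \<in> Delta n \<rightarrow> Delta (n - 1) \<and>
    increasing_on (Delta n) coord_le coord_le (root_map w) \<and>
    ((\<forall>i<n. \<forall>j<n. w ! i = w ! j) \<longrightarrow>
      (\<forall>z\<in>Delta n. \<forall>z'\<in>Delta n.
        levy_dist (empirical_measure (root_map w z)) (empirical_measure (root_map w z'))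
          \<le> real n / (real n - 1) * levy_dist (empirical_measure z) (empirical_measure z')))"
proof (intro conjI impI ballI)
  have w: "\<And>j. j < n \<Longrightarrow> w ! j > 0" and n: "n > 0" using assms by auto
  show "root_map w \<in> Delta n \<rightarrow> Delta (n - 1)"
    using root_map_in_Delta[OF n w] by blast
  show "increasing_on (Delta n) coord_le coord_le (root_map w)"
    using root_map_mono[OF n w] root_map_strict[OF assms(1) w]
    unfolding increasing_on_def by blast
  fix z z' assume "\<forall>i<n. \<forall>j<n. w ! i = w ! j" "z \<in> Delta n" "z' \<in> Delta n"
  then show "levy_dist (empirical_measure (root_map w z)) (empirical_measure (root_map w z'))
      \<le> real n / (real n - 1) * levy_dist (empirical_measure z) (empirical_measure z')"
    using levy_root_map_le[OF assms(1) w] by blast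
qed

end
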